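(* Let $E$ be a subset of a Hilbert space $X$ and let $G:E\to X$ be a strongly biLipschitz mapping. Then $G$ extends to a strongly biLipschitz mapping on $X$ preserving the strong biLipschitz constant $\mathrm{SBilip}(G)$. Moreover, if $\alpha=\mathrm{SBilip}(G)$, the formula $$\widetilde{G}(x):=P_2\big(\nabla(\mathrm{conv}(g))(x,0)\big)+\tfrac1\alpha x,\qquad x\in X,$$ where $P_2(x,y)=y$ for $(x,y)\in X\times X$, and $$g(x,y)=\inf_{z\in E}\left\{\langle G(z),y\rangle-\tfrac1\alpha\langle z,y\rangle+\tfrac{\sqrt{1-\alpha^2}}{2\alpha}\|x-z\|^2\right\}+\tfrac{\sqrt{1-\alpha^2}}{\alpha}\left(\tfrac12\|x\|^2+\|y\|^2\right),\qquad (x,y)\in X\times X,$$ defines such an extension.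
   Context: $\langle\cdot,\cdot\rangle$ and $\|\cdot\|$ denote the inner product and norm of $X$. For a subset $D$ of $X$, a mapping $G:D\to X$ is called strongly biLipschitz provided that $$\mathrm{SBilip}(G):=\inf_{x,y\in D;\,x\neq y}\frac{2\langle x-y,G(x)-G(y)\rangle}{\|x-y\|^2+\|G(x)-G(y)\|^2}>0;$$ the number $\mathrm{SBilip}(G)$ is called the strong biLipschitz constant of $G$. The product $X\times X$ is a Hilbert space with inner product $\langle (x,y),(x',y')\rangle=\langle x,x'\rangle+\langle y,y'\rangle$. For a function $g$ on a Hilbert space $Z$, the convex envelope is $\mathrm{conv}(g)(z)=\sup\{h(z): h \text{ is convex, proper and lower semicontinuous},\ h\le g\}$. $\nabla F$ denotes the gradient of $F$, that is, the vector representing the Fréchet derivative of $F$ through the inner product. *)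

theory Defs
  imports "HOL-Analysis.Analysis"
begin

(* Taken in the extended reals, so that the infimum over the empty set is \<infinity>: the constant
   is a real number exactly when D has at least two points. *)
definition SBilip :: "'a::real_inner set \<Rightarrow> ('a \<Rightarrow> 'a) \<Rightarrow> ereal" where
  "SBilip D G = (INF (x, y) \<in> {(x, y). x \<in> D \<and> y \<in> D \<and> x \<noteq> y}.
     ereal (2 * ((x - y) \<bullet> (G x - G y)) / ((norm (x - y))\<^sup>2 + (norm (G x - G y))\<^sup>2)))"

lemma SBilip_finite_iff:
  fixes D :: "'a::real_inner set" and G :: "'a \<Rightarrow> 'a"
  assumes pos: "SBilip D G > 0"
  shows "(\<exists>\<alpha>. SBilip D G = ereal \<alpha>) \<longleftrightarrow> (\<exists>x\<in>D. \<exists>y\<in>D. x \<noteq> y)"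
proof
  assume ex: "\<exists>\<alpha>. SBilip D G = ereal \<alpha>"
  show "\<exists>x\<in>D. \<exists>y\<in>D. x \<noteq> y"
  proof (rule ccontr)
    assume "\<not> (\<exists>x\<in>D. \<exists>y\<in>D. x \<noteq> y)"
    then have e: "{(x, y). x \<in> D \<and> y \<in> D \<and> x \<noteq> y} = {}" by blast
    have "SBilip D G = \<infinity>"
      unfolding SBilip_def e by (simp add: top_ereal_def)
    with ex show False by simp
  qed
next
  assume "\<exists>x\<in>D. \<exists>y\<in>D. x \<noteq> y"
  then obtain x y where xy: "(x, y) \<in> {(x, y). x \<in> D \<and> y \<in> D \<and> x \<noteq> y}" by blast
  have "SBilip D G \<le> ereal (2 * ((x - y) \<bullet> (G x - G y)) /
      ((norm (x - y))\<^sup>2 + (norm (G x - G y))\<^sup>2))"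
    unfolding SBilip_def by (rule INF_lower2[OF xy]) simp
  with pos show "\<exists>\<alpha>. SBilip D G = ereal \<alpha>"
    by (cases "SBilip D G") simp_all
qed

definition strongly_biLipschitz :: "'a::real_inner set \<Rightarrow> ('a \<Rightarrow> 'a) \<Rightarrow> bool" where
  "strongly_biLipschitz D G \<longleftrightarrow> SBilip D G > 0"

definition SBilip_preserving_extension ::
    "'a::real_inner set \<Rightarrow> ('a \<Rightarrow> 'a) \<Rightarrow> ('a \<Rightarrow> 'a) \<Rightarrow> bool" where
  "SBilip_preserving_extension E G H \<longleftrightarrow>
     (\<forall>x\<in>E. H x = G x) \<and> strongly_biLipschitz UNIV H \<and> SBilip UNIV H = SBilip E G"

definition proper_fun :: "('a \<Rightarrow> ereal) \<Rightarrow> bool" where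
  "proper_fun h \<longleftrightarrow> (\<forall>z. h z \<noteq> -\<infinity>) \<and> (\<exists>z. h z \<noteq> \<infinity>)"

(* Only used together with proper_fun, so that \<infinity> - \<infinity> does not occur on the right. *)
definition convex_fun :: "('a::real_vector \<Rightarrow> ereal) \<Rightarrow> bool" where
  "convex_fun h \<longleftrightarrow> (\<forall>u v. \<forall>t::real. 0 < t \<and> t < 1 \<longrightarrow>
     h ((1 - t) *\<^sub>R u + t *\<^sub>R v) \<le> ereal (1 - t) * h u + ereal t * h v)"

definition lsc_fun :: "('a::topological_space \<Rightarrow> ereal) \<Rightarrow> bool" where
  "lsc_fun h \<longleftrightarrow> (\<forall>z. h z \<le> Liminf (at z) h)"

definition convex_envelope :: "('a::real_inner \<Rightarrow> ereal) \<Rightarrow> 'a \<Rightarrow> ereal" where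
  "convex_envelope g z =
     (SUP h \<in> {h. convex_fun h \<and> proper_fun h \<and> lsc_fun h \<and> (\<forall>w. h w \<le> g w)}. h z)"

definition gradient :: "('a::real_inner \<Rightarrow> real) \<Rightarrow> 'a \<Rightarrow> 'a" where
  "gradient F z = (THE v. GDERIV F z :> v)"

definition ext_aux :: "'a::real_inner set \<Rightarrow> ('a \<Rightarrow> 'a) \<Rightarrow> real \<Rightarrow> 'a \<times> 'a \<Rightarrow> ereal" where
  "ext_aux E G \<alpha> = (\<lambda>(x, y).
     (INF z\<in>E. ereal (G z \<bullet> y - (1 / \<alpha>) * (z \<bullet> y)
                        + sqrt (1 - \<alpha>\<^sup>2) / (2 * \<alpha>) * (norm (x - z))\<^sup>2))
     + ereal (sqrt (1 - \<alpha>\<^sup>2) / \<alpha> * ((norm x)\<^sup>2 / 2 + (norm y)\<^sup>2)))"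

(* The envelope as a real-valued function; meaningful where convex_envelope is finite. *)
definition ext_env :: "'a::real_inner set \<Rightarrow> ('a \<Rightarrow> 'a) \<Rightarrow> real \<Rightarrow> 'a \<times> 'a \<Rightarrow> real" where
  "ext_env E G \<alpha> p = real_of_ereal (convex_envelope (ext_aux E G \<alpha>) p)"

definition explicit_ext :: "'a::real_inner set \<Rightarrow> ('a \<Rightarrow> 'a) \<Rightarrow> real \<Rightarrow> 'a \<Rightarrow> 'a" where
  "explicit_ext E G \<alpha> x = snd (gradient (ext_env E G \<alpha>) (x, 0)) + (1 / \<alpha>) *\<^sub>R x"

end

theory Submission
  imports Defs
begin

text \<open>
  With \<open>M = sqrt (1 - \<alpha>\<^sup>2) / \<alpha>\<close>, a map \<open>G\<close> has strong biLipschitz constant at least \<open>\<alpha>\<close>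
  iff \<open>f = G - (1/\<alpha>) id\<close> is \<open>M\<close>-Lipschitz, so the task is a Kirszbraun extension of \<open>f\<close>.
  The function \<open>g\<close> is \<open>M \<parallel>p\<parallel>\<^sup>2\<close> plus an infimum of affine functions. Suitable convex
  combinations of two translates of \<open>conv g\<close>, lowered by a constant, are convex minorants of \<open>g\<close>, whence
  \<open>M \<parallel>p\<parallel>\<^sup>2 - conv g\<close> is convex as well. Therefore \<open>F = conv g\<close> is differentiable, and its gradient is
  cocoercive, which makes \<open>\<nabla>F - M id\<close> an \<open>M\<close>-Lipschitz map; its second component at \<open>(x, 0)\<close> is
  the extension. For \<open>w \<in> E\<close> the Lipschitz condition on \<open>f\<close> provides an affine minorant of \<open>g\<close>
  touching \<open>F\<close> at \<open>(w, 0)\<close> with slope \<open>(M w, f w)\<close>, so that \<open>\<nabla>F(w, 0) = (M w, f w)\<close>.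
\<close>

section \<open>Riesz representation and gradients of convex semiconcave functions\<close>

lemma inner_representation:
  fixes L :: "'a::{real_inner, complete_space} \<Rightarrow> real"
  assumes "bounded_linear L"
  obtains v where "\<And>d. L d = d \<bullet> v"
proof -
  interpret L: bounded_linear L by fact
  obtain B where B: "\<And>x. \<bar>L x\<bar> \<le> norm x * B"
    using L.bounded by auto
  \<comment> \<open>If \<open>L d = d \<bullet> v\<close>, then \<open>J d\<close> is the squared
    distance from \<open>d\<close> to \<open>v\<close> up to a constant, so the representing vector
    is sought as a minimiser of \<open>J\<close>.\<close>
  define J where "J d = d \<bullet> d - 2 * L d" for d
  have lower: "- B\<^sup>2 \<le> J d" for d
  proof -
    have "0 \<le> (norm d - B)\<^sup>2" by simp
    then show ?thesis
      using B[of d] unfolding J_def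
      by (simp add: power2_eq_square algebra_simps flip: power2_norm_eq_inner)
  qed
  define m where "m = (INF d. J d)"
  have bdd: "bdd_below (range J)"
    using lower by (meson bdd_belowI2)
  have m_le: "m \<le> J d" for d
    unfolding m_def by (rule cINF_lower[OF bdd]) simp
  have "\<exists>d. J d < m + 1 / Suc n" for n
    unfolding m_def using cINF_less_iff[OF _ bdd, of "m + 1 / Suc n"]
    by (auto simp: m_def)
  then obtain s where s: "\<And>n. J (s n) < m + 1 / Suc n"
    by metis
  \<comment> \<open>By the parallelogram law the midpoint of two near-minimisers has an even smaller
    value unless they are close; hence minimising sequences are Cauchy, and completeness yields a
    minimiser.\<close>
  have par: "(norm (a - b))\<^sup>2 \<le> 2 * (J a - m) + 2 * (J b - m)" for a b
  proof -
    have "(norm (a - b))\<^sup>2 = 2 * J a + 2 * J b - 4 * J ((1/2) *\<^sub>R (a + b))"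
      unfolding J_def power2_norm_eq_inner
      by (simp add: L.add L.scaleR inner_simps inner_commute algebra_simps)
    then show ?thesis using m_le[of "(1/2) *\<^sub>R (a + b)"] by simp
  qed
  have "Cauchy s"
  proof (rule metric_CauchyI)
    fix e :: real assume "e > 0"
    then obtain N where N: "1 / Suc N < e\<^sup>2 / 4"
      using nat_approx_posE[of "e\<^sup>2 / 4"] by auto
    have near: "J (s n) - m < e\<^sup>2 / 4" if "n \<ge> N" for n
    proof -
      have "1 / real (Suc n) \<le> 1 / Suc N" using that by (simp add: frac_le)
      then show ?thesis using s[of n] N by linarith
    qed
    have "dist (s i) (s j) < e" if "i \<ge> N" "j \<ge> N" for i j
    proof -
      have "(norm (s i - s j))\<^sup>2 < e\<^sup>2"
        using par[of "s i" "s j"] near[OF that(1)] near[OF that(2)]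
        by argo
      then show ?thesis
        using \<open>e > 0\<close> by (simp add: dist_norm power_less_imp_less_base)
    qed
    then show "\<exists>M. \<forall>i\<ge>M. \<forall>j\<ge>M. dist (s i) (s j) < e" by blast
  qed
  then obtain v where v: "s \<longlonglongrightarrow> v"
    using Cauchy_convergent_iff convergent_def by blast
  have "(\<lambda>n. J (s n)) \<longlonglongrightarrow> J v"
    unfolding J_def by (intro tendsto_intros v L.tendsto)
  moreover have "(\<lambda>n. m + 1 / Suc n) \<longlonglongrightarrow> m + 0"
    by (intro tendsto_intros LIMSEQ_inverse_real_of_nat[unfolded inverse_eq_divide])
  ultimately have "J v \<le> m"
    using LIMSEQ_le[of "\<lambda>n. J (s n)" "J v" "\<lambda>n. m + 1 / Suc n" "m + 0"] s less_imp_le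
    by auto
  then have min: "J v \<le> J d" for d using m_le[of d] by linarith
  have "L d = d \<bullet> v" for d
  proof -
    define e where "e = d \<bullet> v - L d"
    \<comment> \<open>The summand 1 covers \<open>d = 0\<close> as well. Moving from the minimiser
      \<open>v\<close> by \<open>- (t * e)\<close> along \<open>d\<close> would lower
      \<open>J\<close> by at least \<open>t * e\<^sup>2\<close>, so \<open>e\<close>
      vanishes.\<close>
    define t where "t = 1 / (1 + d \<bullet> d)"
    have "0 < 1 + d \<bullet> d" by (simp add: add_pos_nonneg)
    then have t: "0 < t" "t * (d \<bullet> d) \<le> 1"
      by (simp_all add: t_def)
    have "J (v - c *\<^sub>R d) = J v - 2 * c * e + c\<^sup>2 * (d \<bullet> d)" for c
      unfolding J_def e_def
      by (simp add: L.diff L.scaleR inner_diff_left inner_diff_right inner_commute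
          right_diff_distrib power2_eq_square)
    from this[of "t * e"]
    have "J (v - (t * e) *\<^sub>R d) = J v - 2 * t * e\<^sup>2 + t * e\<^sup>2 * (t * (d \<bullet> d))"
      by (simp add: power2_eq_square mult_ac)
    moreover have "t * e\<^sup>2 * (t * (d \<bullet> d)) \<le> t * e\<^sup>2 * 1"
      by (rule mult_left_mono) (use t in auto)
    ultimately have "t * e\<^sup>2 \<le> 0"
      using min[of "v - (t * e) *\<^sub>R d"] by simp
    then have "e = 0" using t by (simp add: mult_le_0_iff)
    then show ?thesis by (simp add: e_def)
  qed
  then show ?thesis by (rule that)
qed

text \<open>Let \<open>L\<close> be the infimum of the difference quotients at \<open>m\<close>,
  which is the one-sided directional derivative. Convexity makes \<open>L\<close> sublinear,
  semiconcavity makes it odd, and together they make it linear. Continuity of \<open>F\<close>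
  bounds it, and Riesz representation turns it into a vector.\<close>

lemma gradient_exists_convex_semiconcave:
  fixes F :: "'a::{real_inner, complete_space} \<Rightarrow> real"
  assumes cvx: "convex_on UNIV F"
    and cont: "continuous_on UNIV F"
    and sc: "\<And>p q t. 0 \<le> t \<Longrightarrow> t \<le> 1 \<Longrightarrow>
      t * F p + (1 - t) * F q - t * (1 - t) * M * (norm (p - q))\<^sup>2 \<le> F (t *\<^sub>R p + (1 - t) *\<^sub>R q)"
  obtains v where "\<And>d. F m + d \<bullet> v \<le> F (m + d)"
    and "\<And>d. F (m + d) \<le> F m + d \<bullet> v + M * (norm d)\<^sup>2"
proof -
  define q where "q t d = (F (m + t *\<^sub>R d) - F m) / t" for t d
  define L where "L d = (INF t\<in>{0<..}. q t d)" for d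
  have cvx': "(s + t) * F ((s / (s + t)) *\<^sub>R a + (t / (s + t)) *\<^sub>R b) \<le> s * F a + t * F b"
    if "0 < s" "0 < t" for s t :: real and a b
  proof -
    have "F ((s / (s + t)) *\<^sub>R a + (t / (s + t)) *\<^sub>R b) \<le> (s / (s + t)) * F a + (t / (s + t)) * F b"
    proof -
      have "s / (s + t) + t / (s + t) = 1"
        using that by (simp add: add_divide_distrib[symmetric])
      moreover have "0 \<le> s / (s + t)" "0 \<le> t / (s + t)" using that by auto
      ultimately show ?thesis using cvx unfolding convex_on_def by blast
    qed
    then have "(s + t) * F ((s / (s + t)) *\<^sub>R a + (t / (s + t)) *\<^sub>R b)
        \<le> (s + t) * ((s / (s + t)) * F a + (t / (s + t)) * F b)"
      using that by (intro mult_left_mono) auto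
    also have "\<dots> = s * F a + t * F b"
    proof -
      have "s + t \<noteq> 0" using that by simp
      then show ?thesis by (simp add: distrib_left del: distrib_right)
    qed
    finally show ?thesis .
  qed
  \<comment> \<open>The point \<open>m\<close> lies between \<open>m - d\<close> and
    \<open>m + t *\<^sub>R d\<close>, so convexity bounds the quotients below uniformly in
    \<open>t\<close> and the infimum \<open>L d\<close> is genuine.\<close>
  have low: "F m - F (m - d) \<le> q t d" if "0 < t" for t d
  proof -
    have "(t / (t + 1)) *\<^sub>R (m - d) + (1 / (t + 1)) *\<^sub>R (m + t *\<^sub>R d)
        = (t / (t + 1) + 1 / (t + 1)) *\<^sub>R m"
      by (simp add: algebra_simps)
    also have "\<dots> = m" using that by (simp add: add_divide_distrib[symmetric])
    finally show ?thesis
      using cvx'[of t 1 "m - d" "m + t *\<^sub>R d"] that by (simp add: q_def field_simps)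
  qed
  have bdd: "bdd_below ((\<lambda>t. q t d) ` {0<..})" for d
    using low by (meson bdd_belowI2 greaterThan_iff)
  have L_le: "L d \<le> q t d" if "0 < t" for t d
    unfolding L_def by (rule cINF_lower[OF bdd]) (use that in simp)
  have L_greatest: "c \<le> L d" if "\<And>t. 0 < t \<Longrightarrow> c \<le> q t d" for c d
    unfolding L_def by (rule cINF_greatest) (use that in auto)
  \<comment> \<open>The step \<open>s * t / (s + t)\<close> is the one for which the point in
    direction \<open>a + b\<close> is a convex combination of \<open>m + s *\<^sub>R a\<close> and
    \<open>m + t *\<^sub>R b\<close>. With \<open>s\<close> and \<open>t\<close> independent, the
    two infima can be taken one after the other.\<close>
  have q_add: "q (s * t / (s + t)) (a + b) \<le> q s a + q t b" if "0 < s" "0 < t" for s t a b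
  proof -
    have "(t / (t + s)) *\<^sub>R (m + s *\<^sub>R a) + (s / (t + s)) *\<^sub>R (m + t *\<^sub>R b)
        = (t / (t + s) + s / (t + s)) *\<^sub>R m + (s * t / (s + t)) *\<^sub>R (a + b)"
      by (simp add: algebra_simps)
    also have "t / (t + s) + s / (t + s) = 1"
      using that by (simp add: add_divide_distrib[symmetric])
    finally have "(t + s) * F (m + (s * t / (s + t)) *\<^sub>R (a + b))
        \<le> t * F (m + s *\<^sub>R a) + s * F (m + t *\<^sub>R b)"
      using cvx'[OF that(2,1), of "m + s *\<^sub>R a" "m + t *\<^sub>R b"] by simp
    then have "((t + s) * F (m + (s * t / (s + t)) *\<^sub>R (a + b)) - (t + s) * F m) / (s * t)
        \<le> (t * F (m + s *\<^sub>R a) + s * F (m + t *\<^sub>R b) - (t + s) * F m) / (s * t)"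
      using that by (intro divide_right_mono) auto
    moreover have "\<dots> = q s a + q t b"
      using that unfolding q_def by (simp add: field_simps)
    moreover have "((t + s) * F (m + (s * t / (s + t)) *\<^sub>R (a + b)) - (t + s) * F m) / (s * t)
        = q (s * t / (s + t)) (a + b)"
      unfolding q_def by (simp add: algebra_simps)
    ultimately show ?thesis by simp
  qed
  have L_add: "L (a + b) \<le> L a + L b" for a b
  proof -
    have "L (a + b) - q s a \<le> q t b" if "0 < s" "0 < t" for s t
      using q_add[OF that, of a b] L_le[of "s * t / (s + t)" "a + b"] that by simp
    then have "L (a + b) - q s a \<le> L b" if "0 < s" for s
      using that by (intro L_greatest)
    then have "L (a + b) - L b \<le> q s a" if "0 < s" for s
      using that by (simp add: diff_le_eq add.commute)
    then have "L (a + b) - L b \<le> L a" by (rule L_greatest)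
    then show ?thesis by simp
  qed
  \<comment> \<open>Semiconcavity on the segment from \<open>m + d\<close> to
    \<open>m - t *\<^sub>R d\<close>, in which \<open>m\<close> divides the segment with weight
    \<open>r\<close> on the first endpoint. Letting \<open>t\<close> tend to 0 gives
    \<open>upper0\<close>.\<close>
  have sc': "F (m + d) - F m + q t (- d) \<le> M * (1 + t) * (norm d)\<^sup>2" if "0 < t" for t d
  proof -
    define r where "r = t / (1 + t)"
    have r: "0 \<le> r" "r \<le> 1" "1 - r = 1 / (1 + t)" "r * (1 + t) = t" "(1 - r) * (1 + t) = 1"
      using that by (auto simp: r_def field_simps)
    have "r *\<^sub>R (m + d) + (1 - r) *\<^sub>R (m - t *\<^sub>R d) = m + (r - (1 - r) * t) *\<^sub>R d"
      by (simp add: algebra_simps)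
    also have "r - (1 - r) * t = 0" using r by (simp add: algebra_simps)
    finally have *: "r *\<^sub>R (m + d) + (1 - r) *\<^sub>R (m - t *\<^sub>R d) = m" by simp
    have "(m + d) - (m - t *\<^sub>R d) = (1 + t) *\<^sub>R d" by (simp add: algebra_simps)
    then have n: "(norm ((m + d) - (m - t *\<^sub>R d)))\<^sup>2 = (1 + t)\<^sup>2 * (norm d)\<^sup>2"
      by (simp add: power_mult_distrib)
    have "r * F (m + d) + (1 - r) * F (m - t *\<^sub>R d) - r * (1 - r) * M * ((1 + t)\<^sup>2 * (norm d)\<^sup>2) \<le> F m"
      using sc[OF r(1,2), of "m + d" "m - t *\<^sub>R d"] unfolding * n .
    moreover have "r * (1 - r) * M * ((1 + t)\<^sup>2 * (norm d)\<^sup>2)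
        = (r * (1 + t)) * ((1 - r) * (1 + t)) * M * (norm d)\<^sup>2"
      by (simp add: power2_eq_square)
    ultimately have "r * F (m + d) + (1 - r) * F (m - t *\<^sub>R d) - t * M * (norm d)\<^sup>2 \<le> F m"
      using r by simp
    then have "(1 + t) * (r * F (m + d) + (1 - r) * F (m - t *\<^sub>R d) - t * M * (norm d)\<^sup>2) \<le> (1 + t) * F m"
      using that by (intro mult_left_mono) auto
    moreover have "(1 + t) * (r * F (m + d) + (1 - r) * F (m - t *\<^sub>R d) - t * M * (norm d)\<^sup>2)
        = (r * (1 + t)) * F (m + d) + ((1 - r) * (1 + t)) * F (m - t *\<^sub>R d) - (1 + t) * t * M * (norm d)\<^sup>2"
      by (simp add: algebra_simps)
    ultimately have "t * F (m + d) + F (m - t *\<^sub>R d) - (1 + t) * t * M * (norm d)\<^sup>2 \<le> (1 + t) * F m"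
      by (simp only: r(4,5) mult_1)
    then show ?thesis using that by (simp add: q_def field_simps)
  qed
  have upper0: "F (m + d) - F m + L (- d) \<le> M * (norm d)\<^sup>2" for d
  proof (rule field_le_epsilon)
    fix e :: real assume "0 < e"
    \<comment> \<open>The sign of \<open>M\<close> is unknown here, hence the absolute value; adding
      1 to \<open>c\<close> keeps the quotient \<open>e / (c + 1)\<close> defined.\<close>
    define c where "c = \<bar>M\<bar> * (norm d)\<^sup>2"
    define t where "t = e / (c + 1)"
    have c: "0 \<le> c" by (simp add: c_def)
    have t: "0 < t" "t * c \<le> e"
      using c \<open>0 < e\<close> by (auto simp: t_def field_simps)
    have "M * (1 + t) * (norm d)\<^sup>2 = M * (norm d)\<^sup>2 + t * (M * (norm d)\<^sup>2)"
      by (simp add: algebra_simps)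
    also have "t * (M * (norm d)\<^sup>2) \<le> t * c"
      using t unfolding c_def by (intro mult_left_mono mult_right_mono) auto
    finally have "M * (1 + t) * (norm d)\<^sup>2 \<le> M * (norm d)\<^sup>2 + e" using t by linarith
    then show "F (m + d) - F m + L (- d) \<le> M * (norm d)\<^sup>2 + e"
      using sc'[OF t(1), of d] L_le[OF t(1), of "- d"] by linarith
  qed
  have L_scale_le: "L (c *\<^sub>R d) \<le> c * L d" if "0 < c" for c d
  proof -
    have "L (c *\<^sub>R d) / c \<le> L d"
    proof (rule L_greatest)
      fix t :: real assume "0 < t"
      have "q (t / c) (c *\<^sub>R d) = c * q t d"
        using that by (simp add: q_def)
      then show "L (c *\<^sub>R d) / c \<le> q t d"
        using L_le[of "t / c" "c *\<^sub>R d"] that \<open>0 < t\<close> by (simp add: field_simps)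
    qed
    then show ?thesis using that by (simp add: field_simps)
  qed
  have L_scale_pos: "L (c *\<^sub>R d) = c * L d" if "0 < c" for c d
    using L_scale_le[OF that, of d] L_scale_le[of "1 / c" "c *\<^sub>R d"] that
    by (simp add: field_simps)
  have L0: "L 0 = 0"
    using L_scale_pos[of 2 0] by simp
  \<comment> \<open>Apply \<open>upper0\<close> to \<open>t *\<^sub>R d\<close>: the left side is at
    least \<open>t * (L d + L (- d))\<close>, linear in \<open>t\<close>, while the right side is
    quadratic in \<open>t\<close>. Small \<open>t\<close> leaves no room for a positive sum.\<close>
  have L_minus: "L (- d) = - L d" for d
  proof (rule antisym)
    have "L d + L (- d) \<le> 0"
    proof (rule field_le_epsilon)
      fix e :: real assume "0 < e"
      define c where "c = \<bar>M\<bar> * (norm d)\<^sup>2"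
      define t where "t = e / (c + 1)"
      have c: "0 \<le> c" by (simp add: c_def)
      have t: "0 < t" "t * c \<le> e"
        using c \<open>0 < e\<close> by (auto simp: t_def field_simps)
      have "t * (L d + L (- d)) = L (t *\<^sub>R d) + L (- (t *\<^sub>R d))"
        using L_scale_pos[OF t(1), of d] L_scale_pos[OF t(1), of "- d"] by (simp add: algebra_simps)
      also have "\<dots> \<le> M * (norm (t *\<^sub>R d))\<^sup>2"
        using upper0[of "t *\<^sub>R d"] L_le[of 1 "t *\<^sub>R d"] by (simp add: q_def)
      also have "\<dots> = t * (t * (M * (norm d)\<^sup>2))"
        using t by (simp add: power_mult_distrib power2_eq_square)
      also have "\<dots> \<le> t * (t * c)"
        using t unfolding c_def by (intro mult_left_mono mult_right_mono) auto
      finally show "L d + L (- d) \<le> 0 + e" using t by simp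
    qed
    then show "L (- d) \<le> - L d" by simp
    show "- L d \<le> L (- d)" using L_add[of d "- d"] L0 by simp
  qed
  have upper: "F (m + d) \<le> F m + L d + M * (norm d)\<^sup>2" for d
    using upper0[of d] L_minus by simp
  have lower: "F m + L d \<le> F (m + d)" for d
    using L_le[of 1 d] by (simp add: q_def)
  have lin: "linear L"
  proof
    show "L (a + b) = L a + L b" for a b
      using L_add[of a b] L_add[of "- a" "- b"] L_minus[of a] L_minus[of b] L_minus[of "a + b"]
      by simp
    show "L (c *\<^sub>R d) = c *\<^sub>R L d" for c d
    proof (cases "c = 0")
      case False
      then consider "0 < c" | "0 < - c" by linarith
      then show ?thesis
        using L_scale_pos[of c d] L_scale_pos[of "- c" d] L_minus[of "c *\<^sub>R d"] by cases auto
    qed (simp add: L0)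
  qed
  obtain r where r: "0 < r" "\<And>x. dist x m < r \<Longrightarrow> \<bar>F x - F m\<bar> < 1"
    using cont unfolding continuous_on_iff dist_real_def by (metis UNIV_I zero_less_one)
  \<comment> \<open>Rescale \<open>d\<close> to length \<open>r / 2\<close>, where \<open>F\<close>
    exceeds \<open>F m\<close> by less than 1; \<open>L\<close> lies below that increment.\<close>
  have L_bound: "L d \<le> norm d * (2 / r)" for d
  proof (cases "d = 0")
    case False
    define c where "c = r / (2 * norm d)"
    have c: "0 < c" "norm (c *\<^sub>R d) < r"
      using r False by (auto simp: c_def)
    have "c * L d = L (c *\<^sub>R d)" using L_scale_pos c by simp
    also have "\<dots> \<le> 1"
      using lower[of "c *\<^sub>R d"] r(2)[of "m + c *\<^sub>R d"] c by (simp add: dist_norm)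
    finally show ?thesis using r False by (simp add: c_def field_simps)
  qed (simp add: L0)
  have "bounded_linear L"
  proof (rule bounded_linear.intro[OF lin], unfold_locales)
    have "norm (L x) \<le> norm x * (2 / r)" for x
      using L_bound[of x] L_bound[of "- x"] L_minus[of x] by (simp add: abs_le_iff)
    then show "\<exists>K. \<forall>x. norm (L x) \<le> norm x * K" by blast
  qed
  then obtain v where v: "\<And>d. L d = d \<bullet> v"
    using inner_representation by blast
  show ?thesis
    by (rule that[of v]) (use lower upper v in auto)
qed

lemma GDERIV_quadratic_bounds:
  fixes F :: "'a::real_inner \<Rightarrow> real"
  assumes "\<And>d. F m + d \<bullet> v \<le> F (m + d)"
    and "\<And>d. F (m + d) \<le> F m + d \<bullet> v + M * (norm d)\<^sup>2"
  shows "GDERIV F m :> v"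
  unfolding gderiv_def
proof (rule has_derivativeI_sandwich[where e = 1 and H = "\<lambda>y. M * norm (y - m)"])
  show "bounded_linear (\<lambda>h. h \<bullet> v)" by (rule bounded_linear_inner_left)
  show "((\<lambda>y. M * norm (y - m)) \<longlongrightarrow> 0) (at m)"
    by (auto intro!: tendsto_eq_intros)
  show "norm (F y - F m - (y - m) \<bullet> v) / norm (y - m) \<le> M * norm (y - m)"
    if "y \<noteq> m" for y
    using assms(1)[of "y - m"] assms(2)[of "y - m"] that
    by (simp add: field_simps power2_eq_square)
qed simp

lemma GDERIV_unique:
  assumes "GDERIV F x :> v" and "GDERIV F x :> w"
  shows "v = w"
proof -
  have "(\<lambda>h. h \<bullet> v) = (\<lambda>h. h \<bullet> w)"
    using assms unfolding gderiv_def by (rule has_derivative_unique)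
  then have "(v - w) \<bullet> v = (v - w) \<bullet> w" by (rule fun_cong)
  then have "(v - w) \<bullet> (v - w) = 0" by (simp add: inner_diff_right)
  then show ?thesis by simp
qed

lemma gradient_eqI: "GDERIV F x :> v \<Longrightarrow> gradient F x = v"
  unfolding gradient_def by (blast intro: GDERIV_unique)

text \<open>Subtracting the affine minorant leaves a function with a minimum at \<open>m\<close>,
  whose derivative there is zero. This identifies the gradient of the envelope over
  \<open>E\<close>.\<close>

lemma GDERIV_affine_minorant:
  assumes F: "GDERIV F m :> v" and le: "\<And>d. F m + d \<bullet> w \<le> F (m + d)"
  shows "v = w"
proof -
  have "((\<lambda>x. F x - x \<bullet> w) has_derivative (\<lambda>h. h \<bullet> v - h \<bullet> w)) (at m)"
    using F unfolding gderiv_def by (auto intro!: derivative_eq_intros)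
  moreover have "F m - m \<bullet> w \<le> F y - y \<bullet> w" for y
    using le[of "y - m"] by (simp add: inner_diff_left)
  ultimately have "(\<lambda>h. h \<bullet> v - h \<bullet> w) = (\<lambda>h. 0)"
    by (intro has_derivative_local_min) auto
  then have "(v - w) \<bullet> v - (v - w) \<bullet> w = 0" by (rule fun_cong)
  then have "(v - w) \<bullet> (v - w) = 0" by (simp add: inner_diff_right)
  then show ?thesis by simp
qed

text \<open>At \<open>p - t *\<^sub>R u\<close> the affine minorant from \<open>q\<close> lies below
  the quadratic majorant from \<open>p\<close>, and at \<open>q + t *\<^sub>R u\<close> the roles
  are exchanged. Adding the two inequalities cancels the values of \<open>F\<close>.\<close>

lemma gradient_cocoercive:
  fixes F :: "'a::real_inner \<Rightarrow> real"
  assumes low: "\<And>d. F p + d \<bullet> v \<le> F (p + d)" "\<And>d. F q + d \<bullet> w \<le> F (q + d)"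
    and upp: "\<And>d. F (p + d) \<le> F p + d \<bullet> v + M * (norm d)\<^sup>2"
      "\<And>d. F (q + d) \<le> F q + d \<bullet> w + M * (norm d)\<^sup>2"
    and M: "0 \<le> M"
  shows "(norm (v - w))\<^sup>2 \<le> 2 * M * ((p - q) \<bullet> (v - w))"
proof -
  define u where "u = v - w"
  have step: "2 * t * (norm u)\<^sup>2 - 2 * M * t\<^sup>2 * (norm u)\<^sup>2 \<le> (p - q) \<bullet> u" for t
  proof -
    have "F q + (p - q - t *\<^sub>R u) \<bullet> w \<le> F p + (- t *\<^sub>R u) \<bullet> v + M * (norm (t *\<^sub>R u))\<^sup>2"
      using low(2)[of "p - q - t *\<^sub>R u"] upp(1)[of "- t *\<^sub>R u"] by (simp add: algebra_simps)
    moreover have "F p + (q - p + t *\<^sub>R u) \<bullet> v \<le> F q + (t *\<^sub>R u) \<bullet> w + M * (norm (t *\<^sub>R u))\<^sup>2"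
      using low(1)[of "q - p + t *\<^sub>R u"] upp(2)[of "t *\<^sub>R u"] by (simp add: algebra_simps)
    ultimately have "(p - q - t *\<^sub>R u) \<bullet> w + (q - p + t *\<^sub>R u) \<bullet> v
        + t * (u \<bullet> v) - t * (u \<bullet> w) \<le> 2 * M * (t\<^sup>2 * (norm u)\<^sup>2)"
      by (simp add: power_mult_distrib)
    moreover have "(p - q - t *\<^sub>R u) \<bullet> w + (q - p + t *\<^sub>R u) \<bullet> v + t * (u \<bullet> v) - t * (u \<bullet> w)
        = 2 * t * (u \<bullet> u) - (p - q) \<bullet> u"
      unfolding u_def by (simp add: inner_simps algebra_simps inner_commute)
    ultimately show ?thesis by (simp add: power2_norm_eq_inner)
  qed
  show ?thesis
  proof (cases "M = 0")
    case True
    have "(norm u)\<^sup>2 = 0"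
    proof (rule ccontr)
      assume "(norm u)\<^sup>2 \<noteq> 0"
      \<comment> \<open>With \<open>M = 0\<close> the bound in \<open>step\<close> is linear in
        \<open>t\<close>; this \<open>t\<close> makes its left side exceed the right side by
        1.\<close>
      then show False
        using step[of "((p - q) \<bullet> u + 1) / (2 * (norm u)\<^sup>2)"] True by (simp add: field_simps)
    qed
    then show ?thesis using True by (simp add: u_def)
  next
    case False
    \<comment> \<open>The choice \<open>1 / (2 * M)\<close> maximises the left side of
      \<open>step\<close> over \<open>t\<close>.\<close>
    then show ?thesis
      using step[of "1 / (2 * M)"] M by (simp add: field_simps power2_eq_square u_def)
  qed
qed

text \<open>Expanding the square turns cocoercivity into this bound: \<open>v - w\<close> lies in
  the ball having the segment from 0 to \<open>(2 * M) *\<^sub>R (p - q)\<close> as a diameter.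
  Recentring at the midpoint halves the constant.\<close>

lemma gradient_Lipschitz_shifted:
  fixes F :: "'a::real_inner \<Rightarrow> real"
  assumes "\<And>d. F p + d \<bullet> v \<le> F (p + d)" "\<And>d. F q + d \<bullet> w \<le> F (q + d)"
    and "\<And>d. F (p + d) \<le> F p + d \<bullet> v + M * (norm d)\<^sup>2"
      "\<And>d. F (q + d) \<le> F q + d \<bullet> w + M * (norm d)\<^sup>2"
    and M: "0 \<le> M"
  shows "norm ((v - w) - M *\<^sub>R (p - q)) \<le> M * norm (p - q)"
proof (rule power2_le_imp_le)
  have "(norm ((v - w) - M *\<^sub>R (p - q)))\<^sup>2
      = (norm (v - w))\<^sup>2 - 2 * M * ((p - q) \<bullet> (v - w)) + (M * norm (p - q))\<^sup>2"
    unfolding power_mult_distrib power2_norm_eq_inner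
    by (simp add: inner_diff_left inner_diff_right inner_commute algebra_simps power2_eq_square)
  then show "(norm ((v - w) - M *\<^sub>R (p - q)))\<^sup>2 \<le> (M * norm (p - q))\<^sup>2"
    using gradient_cocoercive[OF assms] by simp
qed (use M in simp)

section \<open>Convex envelopes of semiconcave functions\<close>

lemma convex_fun_ereal_iff:
  "convex_fun (\<lambda>z. ereal (h z)) \<longleftrightarrow> convex_on UNIV h"
proof
  assume h: "convex_fun (\<lambda>z. ereal (h z))"
  show "convex_on UNIV h"
    by (rule convex_onI) (use h in \<open>auto simp: convex_fun_def\<close>)
next
  assume h: "convex_on UNIV h"
  show "convex_fun (\<lambda>z. ereal (h z))"
    using convex_onD[OF h] by (auto simp: convex_fun_def)
qed

lemma lsc_fun_continuous:
  fixes h :: "'a::real_normed_vector \<Rightarrow> real"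
  assumes "continuous_on UNIV h"
  shows "lsc_fun (\<lambda>z. ereal (h z))"
  unfolding lsc_fun_def
proof
  fix z
  show "ereal (h z) \<le> Liminf (at z) (\<lambda>z. ereal (h z))"
  proof (cases "trivial_limit (at z)")
    case False
    have "((\<lambda>z. ereal (h z)) \<longlongrightarrow> ereal (h z)) (at z)"
      using assms by (auto simp: continuous_on_def)
    from lim_imp_Liminf[OF False this] show ?thesis by simp
  qed simp
qed

lemma convex_envelope_le: "convex_envelope g z \<le> g z"
  unfolding convex_envelope_def by (rule SUP_least) auto

lemma convex_envelope_ge:
  fixes h :: "'a::real_inner \<Rightarrow> real"
  assumes "convex_on UNIV h" "continuous_on UNIV h" "\<And>w. ereal (h w) \<le> g w"
  shows "ereal (h z) \<le> convex_envelope g z"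
  unfolding convex_envelope_def
  by (rule SUP_upper2[where i = "\<lambda>z. ereal (h z)"])
     (use assms in \<open>auto simp: convex_fun_ereal_iff lsc_fun_continuous proper_fun_def\<close>)

text \<open>In infinite dimensions a finite convex function may be discontinuous. Local boundedness
  restores continuity, and the two continuous bounds supply it.\<close>

lemma convex_on_continuous_of_le:
  fixes F :: "'a::real_inner \<Rightarrow> real"
  assumes cvx: "convex_on UNIV F"
    and l: "continuous_on UNIV l" "\<And>p. l p \<le> F p"
    and u: "continuous_on UNIV u" "\<And>p. F p \<le> u p"
  shows "continuous_on UNIV F"
proof -
  have "isCont F p" for p
  proof -
    obtain r where r: "0 < r" "\<And>x. dist x p < r \<Longrightarrow> \<bar>u x - u p\<bar> < 1"
      using u(1) unfolding continuous_on_iff dist_real_def by (metis UNIV_I zero_less_one)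
    obtain r' where r': "0 < r'" "\<And>x. dist x p < r' \<Longrightarrow> \<bar>l x - l p\<bar> < 1"
      using l(1) unfolding continuous_on_iff dist_real_def by (metis UNIV_I zero_less_one)
    define S where "S = ball p (min r r')"
    have "continuous_on S F"
    proof (rule convex_on_bounded_continuous)
      show "open S" by (simp add: S_def)
      show "convex_on S F"
        by (rule convex_on_subset[OF cvx]) (auto simp: S_def)
      show "\<forall>x\<in>S. \<bar>F x\<bar> \<le> \<bar>u p\<bar> + \<bar>l p\<bar> + 1"
      proof
        fix x assume "x \<in> S"
        then have "\<bar>u x - u p\<bar> < 1" "\<bar>l x - l p\<bar> < 1"
          using r(2) r'(2) by (auto simp: S_def dist_commute)
        then show "\<bar>F x\<bar> \<le> \<bar>u p\<bar> + \<bar>l p\<bar> + 1"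
          using l(2)[of x] u(2)[of x] by linarith
      qed
    qed
    moreover have "p \<in> S" "open S" using r r' by (auto simp: S_def)
    ultimately show ?thesis by (simp add: continuous_on_eq_continuous_at)
  qed
  then show ?thesis by (simp add: continuous_on_eq_continuous_at)
qed

text \<open>The continuous convex minorant \<open>l\<close> keeps the envelope finite; together with
  the majorant \<open>u\<close> it makes the envelope locally bounded, hence continuous.\<close>

locale semiconcave_envelope =
  fixes g l u :: "'a::real_inner \<Rightarrow> real" and M :: real
  assumes semiconcave: "concave_on UNIV (\<lambda>p. g p - M * (norm p)\<^sup>2)"
    and l: "convex_on UNIV l" "continuous_on UNIV l" "\<And>p. l p \<le> g p"
    and u: "continuous_on UNIV u" "\<And>p. g p \<le> u p"
begin

definition env :: "'a \<Rightarrow> real" where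
  "env p = real_of_ereal (convex_envelope (\<lambda>p. ereal (g p)) p)"

lemma ereal_env: "ereal (env p) = convex_envelope (\<lambda>p. ereal (g p)) p"
proof -
  have "ereal (l p) \<le> convex_envelope (\<lambda>p. ereal (g p)) p"
    by (rule convex_envelope_ge) (use l in auto)
  then show ?thesis
    using convex_envelope_le[of "\<lambda>p. ereal (g p)" p] unfolding env_def
    by (cases "convex_envelope (\<lambda>p. ereal (g p)) p") auto
qed

lemma env_le: "env p \<le> g p"
  using convex_envelope_le[of "\<lambda>p. ereal (g p)" p] by (simp flip: ereal_env)

lemma env_ge:
  assumes "convex_on UNIV h" "continuous_on UNIV h" "\<And>w. h w \<le> g w"
  shows "h p \<le> env p"
  using convex_envelope_ge[of h "\<lambda>p. ereal (g p)" p] assms by (simp flip: ereal_env)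

lemma convex_env: "convex_on UNIV env"
proof -
  have "convex_fun (\<lambda>p. ereal (env p))"
    unfolding convex_fun_def
  proof (intro allI impI)
    fix a b :: 'a and t :: real assume t: "0 < t \<and> t < 1"
    have "convex_envelope (\<lambda>p. ereal (g p)) ((1 - t) *\<^sub>R a + t *\<^sub>R b)
        \<le> ereal ((1 - t) * env a + t * env b)"
      unfolding convex_envelope_def
    proof (rule SUP_least)
      fix h
      assume h: "h \<in> {h. convex_fun h \<and> proper_fun h \<and> lsc_fun h \<and> (\<forall>w. h w \<le> ereal (g w))}"
      have le: "h w \<le> ereal (env w)" for w
        unfolding ereal_env convex_envelope_def using h by (rule SUP_upper)
      have "h ((1 - t) *\<^sub>R a + t *\<^sub>R b) \<le> ereal (1 - t) * h a + ereal t * h b"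
        using h t by (auto simp: convex_fun_def)
      also have "\<dots> \<le> ereal (1 - t) * ereal (env a) + ereal t * ereal (env b)"
        by (intro add_mono ereal_mult_left_mono le) (use t in auto)
      finally show "h ((1 - t) *\<^sub>R a + t *\<^sub>R b) \<le> ereal ((1 - t) * env a + t * env b)"
        by simp
    qed
    then show "ereal (env ((1 - t) *\<^sub>R a + t *\<^sub>R b))
        \<le> ereal (1 - t) * ereal (env a) + ereal t * ereal (env b)"
      by (simp flip: ereal_env)
  qed
  then show ?thesis by (simp add: convex_fun_ereal_iff)
qed

text \<open>Continuity lets functions built from translates of \<open>env\<close> compete in
  \<open>env_ge\<close>, and later bounds the derivative.\<close>

lemma continuous_env: "continuous_on UNIV env"
  using convex_env l(2) _ u(1)
proof (rule convex_on_continuous_of_le)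
  show "l p \<le> env p" for p using l by (rule env_ge)
  show "env p \<le> u p" for p using env_le u(2) order_trans by blast
qed

text \<open>The two translates are evaluated at points with weighted mean \<open>x\<close> and fixed
  difference \<open>d\<close>. The semiconcavity defect of \<open>g\<close> is therefore the same
  constant at every \<open>x\<close>, so subtracting it keeps \<open>h\<close> convex. Since
  \<open>env\<close> lies below \<open>g\<close>, so does \<open>h\<close>, hence \<open>h\<close>
  lies below \<open>env\<close>.\<close>

lemma env_semiconcave:
  assumes t: "0 \<le> t" "t \<le> 1"
  shows "t * env p + (1 - t) * env q - t * (1 - t) * M * (norm (p - q))\<^sup>2
    \<le> env (t *\<^sub>R p + (1 - t) *\<^sub>R q)"
proof -
  define d where "d = p - q"
  define h where "h x = t * env (x + (1 - t) *\<^sub>R d) + (1 - t) * env (x + (- t) *\<^sub>R d)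
    + (- (t * (1 - t) * M * (norm d)\<^sup>2))" for x
  have shift: "convex_on UNIV (\<lambda>x. env (x + c))" for c
  proof (rule convex_onI)
    fix s :: real and x y :: 'a assume "0 < s" "s < 1"
    have "(1 - s) *\<^sub>R x + s *\<^sub>R y + c = (1 - s) *\<^sub>R (x + c) + s *\<^sub>R (y + c)"
      by (simp add: algebra_simps)
    then show "env ((1 - s) *\<^sub>R x + s *\<^sub>R y + c) \<le> (1 - s) * env (x + c) + s * env (y + c)"
      using convex_onD[OF convex_env, of s "x + c" "y + c"] \<open>0 < s\<close> \<open>s < 1\<close> by simp
  qed simp
  have hx: "h (t *\<^sub>R p + (1 - t) *\<^sub>R q) \<le> env (t *\<^sub>R p + (1 - t) *\<^sub>R q)"
  proof (rule env_ge)
    show "convex_on UNIV h"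
      unfolding h_def using t by (intro convex_on_add convex_on_cmul shift convex_on_const[THEN iffD2]) auto
    show "continuous_on UNIV h"
      unfolding h_def
      by (intro continuous_intros continuous_on_compose2[OF continuous_env]) auto
    show "h x \<le> g x" for x
    proof -
      define a b where "a = x + (1 - t) *\<^sub>R d" and "b = x + (- t) *\<^sub>R d"
      have x: "x = t *\<^sub>R a + (1 - t) *\<^sub>R b"
        unfolding a_def b_def by (simp add: algebra_simps)
      have ab: "d = a - b" unfolding a_def b_def by (simp add: algebra_simps)
      have "- (g (t *\<^sub>R a + (1 - t) *\<^sub>R b) - M * (norm (t *\<^sub>R a + (1 - t) *\<^sub>R b))\<^sup>2)
          \<le> t * - (g a - M * (norm a)\<^sup>2) + (1 - t) * - (g b - M * (norm b)\<^sup>2)"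
        using semiconcave t unfolding concave_on_def convex_on_def by auto
      then have "t * (g a - M * (norm a)\<^sup>2) + (1 - t) * (g b - M * (norm b)\<^sup>2)
          \<le> g x - M * (norm x)\<^sup>2"
        unfolding x by (simp only: mult_minus_right)
      moreover have "t * (norm a)\<^sup>2 + (1 - t) * (norm b)\<^sup>2 - t * (1 - t) * (norm d)\<^sup>2 = (norm x)\<^sup>2"
        unfolding x ab power2_norm_eq_inner
        by (simp add: inner_simps inner_commute algebra_simps power2_eq_square)
      then have "M * (norm x)\<^sup>2
          = t * (M * (norm a)\<^sup>2) + (1 - t) * (M * (norm b)\<^sup>2) - t * (1 - t) * M * (norm d)\<^sup>2"
        by (simp add: algebra_simps flip: \<open>_ = (norm x)\<^sup>2\<close>)
      ultimately have "t * g a + (1 - t) * g b - t * (1 - t) * M * (norm d)\<^sup>2 \<le> g x"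
        by (simp add: algebra_simps)
      moreover have "t * env a + (1 - t) * env b \<le> t * g a + (1 - t) * g b"
        using t by (intro add_mono mult_left_mono env_le) auto
      ultimately show ?thesis
        unfolding h_def a_def b_def by simp
    qed
  qed
  have "t *\<^sub>R p + (1 - t) *\<^sub>R q + (1 - t) *\<^sub>R d = p" "t *\<^sub>R p + (1 - t) *\<^sub>R q + (- t) *\<^sub>R d = q"
    by (simp_all add: d_def algebra_simps)
  with hx show ?thesis by (simp add: h_def flip: d_def)
qed

end

section \<open>The function g of the theorem and the gradient of its envelope\<close>

locale Lipschitz_data =
  fixes E :: "'a::{real_inner, complete_space} set" and f :: "'a \<Rightarrow> 'a" and M :: real
  assumes nonempty: "E \<noteq> {}"
    and nonneg: "0 \<le> M"
    and Lipschitz: "\<And>x y. x \<in> E \<Longrightarrow> y \<in> E \<Longrightarrow> norm (f x - f y) \<le> M * norm (x - y)"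
begin

text \<open>The summand independent of \<open>z\<close>, which \<open>ext_aux\<close> adds after the
  infimum, is moved inside, so that each \<open>upper z\<close> is a full quadratic majorant of
  \<open>g\<close>.\<close>

definition upper :: "'a \<Rightarrow> 'a \<times> 'a \<Rightarrow> real" where
  "upper z p = f z \<bullet> snd p + M / 2 * (norm (fst p - z))\<^sup>2
    + M * ((norm (fst p))\<^sup>2 / 2 + (norm (snd p))\<^sup>2)"

text \<open>Its slope is the gradient that the envelope should have at \<open>(w, 0)\<close>, and
  its value there equals \<open>upper w (w, 0)\<close>, so the envelope is pinched at that
  point.\<close>

definition lower :: "'a \<Rightarrow> 'a \<times> 'a \<Rightarrow> real" where
  "lower w p = M / 2 * (norm w)\<^sup>2 + (p - (w, 0)) \<bullet> (M *\<^sub>R w, f w)"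

definition g :: "'a \<times> 'a \<Rightarrow> real" where
  "g p = (INF z\<in>E. upper z p)"

text \<open>The two half squares of \<open>fst p\<close> add up to a full one, so the quadratic part
  is the same for all \<open>z\<close>. What remains is affine in \<open>p\<close>, and an infimum
  of such terms is concave.\<close>

lemma upper_eq:
  "upper z p = M * (norm p)\<^sup>2 + (p \<bullet> (- M *\<^sub>R z, f z) + M / 2 * (norm z)\<^sup>2)"
  unfolding upper_def power2_norm_eq_inner
  by (cases p) (simp add: inner_prod_def inner_diff_left inner_diff_right inner_commute field_simps)

text \<open>Completing squares in both coordinates of \<open>p\<close> reduces the claim to the Lipschitz estimate.\<close>

lemma lower_le_upper:
  assumes "w \<in> E" "z \<in> E"
  shows "lower w p \<le> upper z p"
proof -
  obtain x y where p: "p = (x, y)" by (cases p)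
  have le: "(norm (f z - f w))\<^sup>2 \<le> (M * norm (z - w))\<^sup>2"
    using Lipschitz[OF assms(2,1)] by (simp add: power_mono)
  show ?thesis
  proof (cases "M = 0")
    \<comment> \<open>Here \<open>f\<close> is constant on \<open>E\<close>, and both sides reduce
      to the inner product of that constant with \<open>y\<close>.\<close>
    case True
    then show ?thesis
      unfolding p lower_def upper_def using le by (simp add: inner_commute)
  next
    case False
    have "4 * M * (upper z p - lower w p) = (norm ((2 * M) *\<^sub>R y + (f z - f w)))\<^sup>2
        + (norm ((2 * M) *\<^sub>R x - M *\<^sub>R (z + w)))\<^sup>2
        + ((M * norm (z - w))\<^sup>2 - (norm (f z - f w))\<^sup>2)"
      unfolding p upper_def lower_def power_mult_distrib power2_norm_eq_inner
      by (simp add: inner_add_left inner_add_right inner_diff_left inner_diff_right inner_commute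
          power2_eq_square field_simps)
    then have "0 \<le> 4 * M * (upper z p - lower w p)" using le by simp
    then show ?thesis using False nonneg by (simp add: zero_le_mult_iff)
  qed
qed

lemma bdd_upper: "bdd_below ((\<lambda>z. upper z p) ` E)"
  using nonempty lower_le_upper by (meson bdd_belowI2 ex_in_conv)

lemma g_le: "z \<in> E \<Longrightarrow> g p \<le> upper z p"
  unfolding g_def by (rule cINF_lower[OF bdd_upper])

lemma g_greatest: "(\<And>z. z \<in> E \<Longrightarrow> c \<le> upper z p) \<Longrightarrow> c \<le> g p"
  unfolding g_def by (rule cINF_greatest[OF nonempty])

lemma concave_g: "concave_on UNIV (\<lambda>p. g p - M * (norm p)\<^sup>2)"
  unfolding concave_on_def
proof (rule convex_onI)
  fix t :: real and a b :: "'a \<times> 'a" assume t: "0 < t" "t < 1"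
  define c where "c = (1 - t) *\<^sub>R a + t *\<^sub>R b"
  have "(1 - t) * (g a - M * (norm a)\<^sup>2) + t * (g b - M * (norm b)\<^sup>2) + M * (norm c)\<^sup>2 \<le> g c"
  proof (rule g_greatest)
    fix z assume z: "z \<in> E"
    have "(1 - t) * (g a - M * (norm a)\<^sup>2) + t * (g b - M * (norm b)\<^sup>2)
      \<le> (1 - t) * (upper z a - M * (norm a)\<^sup>2) + t * (upper z b - M * (norm b)\<^sup>2)"
      using t g_le[OF z] by (intro add_mono mult_left_mono) auto
    also have "\<dots> = upper z c - M * (norm c)\<^sup>2"
      unfolding upper_eq c_def by (simp add: inner_add_left inner_diff_left field_simps)
    finally show "(1 - t) * (g a - M * (norm a)\<^sup>2) + t * (g b - M * (norm b)\<^sup>2) + M * (norm c)\<^sup>2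
      \<le> upper z c" by simp
  qed
  then show "- (g c - M * (norm c)\<^sup>2) \<le> (1 - t) * - (g a - M * (norm a)\<^sup>2) + t * - (g b - M * (norm b)\<^sup>2)"
    by (simp only: mult_minus_right)
qed simp

lemma semiconcave_envelope:
  assumes w: "w \<in> E"
  shows "semiconcave_envelope g (lower w) (upper w) M"
proof
  show "concave_on UNIV (\<lambda>p. g p - M * (norm p)\<^sup>2)" by (rule concave_g)
  show "convex_on UNIV (lower w)"
    by (rule convex_onI) (simp_all add: lower_def inner_diff_left inner_add_left field_simps)
  show "continuous_on UNIV (lower w)" "continuous_on UNIV (upper w)"
    unfolding lower_def[abs_def] upper_def[abs_def] by (intro continuous_intros; simp)+
  show "lower w p \<le> g p" for p using lower_le_upper[OF w] by (rule g_greatest)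
  show "g p \<le> upper w p" for p using w by (rule g_le)
qed

text \<open>An arbitrary point of \<open>E\<close> supplies the bounds. The envelope depends on
  \<open>g\<close> alone, so facts about it combine with the bounds belonging to any other
  point.\<close>

sublocale env: semiconcave_envelope g "lower (SOME w. w \<in> E)" "upper (SOME w. w \<in> E)" M
  by (rule semiconcave_envelope) (use nonempty some_in_eq in blast)

lemma env_gradient:
  obtains v where "\<And>d. env.env m + d \<bullet> v \<le> env.env (m + d)"
    and "\<And>d. env.env (m + d) \<le> env.env m + d \<bullet> v + M * (norm d)\<^sup>2"
  using gradient_exists_convex_semiconcave[OF env.convex_env env.continuous_env env.env_semiconcave]
  by blast

lemma gradient_env_bounds:
  "env.env m + d \<bullet> gradient env.env m \<le> env.env (m + d)"
  "env.env (m + d) \<le> env.env m + d \<bullet> gradient env.env m + M * (norm d)\<^sup>2"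
proof -
  obtain v where v: "\<And>d. env.env m + d \<bullet> v \<le> env.env (m + d)"
    "\<And>d. env.env (m + d) \<le> env.env m + d \<bullet> v + M * (norm d)\<^sup>2"
    using env_gradient[of m] by blast
  then have "gradient env.env m = v"
    by (intro gradient_eqI GDERIV_quadratic_bounds)
  then show "env.env m + d \<bullet> gradient env.env m \<le> env.env (m + d)"
    "env.env (m + d) \<le> env.env m + d \<bullet> gradient env.env m + M * (norm d)\<^sup>2"
    using v by auto
qed

lemma env_GDERIV: "GDERIV env.env m :> gradient env.env m"
  using gradient_env_bounds by (rule GDERIV_quadratic_bounds)

text \<open>The affine function \<open>lower w\<close> is a competitor for the envelope and meets
  the majorant \<open>upper w\<close> at \<open>(w, 0)\<close>; hence it supports the envelope
  there.\<close>

lemma gradient_env_on: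
  assumes w: "w \<in> E"
  shows "gradient env.env (w, 0) = (M *\<^sub>R w, f w)"
proof (rule GDERIV_affine_minorant[OF env_GDERIV])
  interpret w: semiconcave_envelope g "lower w" "upper w" M
    using w by (rule semiconcave_envelope)
  have low: "lower w p \<le> env.env p" for p
    using w.l by (rule env.env_ge)
  have "env.env (w, 0) \<le> upper w (w, 0)"
    using env.env_le g_le[OF w] by (rule order_trans)
  then have "env.env (w, 0) \<le> M / 2 * (norm w)\<^sup>2"
    by (simp add: upper_def)
  then show "env.env (w, 0) + d \<bullet> (M *\<^sub>R w, f w) \<le> env.env ((w, 0) + d)" for d
    using low[of "(w, 0) + d"] by (simp add: lower_def)
qed

text \<open>The shift by \<open>M\<close> times \<open>(x, 0) - (y, 0)\<close> has zero second
  component, so projecting the shifted estimate removes it without loss in the constant.\<close>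

lemma snd_gradient_env_Lipschitz:
  "norm (snd (gradient env.env (x, 0)) - snd (gradient env.env (y, 0))) \<le> M * norm (x - y)"
proof -
  let ?v = "gradient env.env (x, 0)" and ?w = "gradient env.env (y, 0)"
  have "norm (snd ((?v - ?w) - M *\<^sub>R ((x, 0) - (y, 0)))) \<le> norm ((?v - ?w) - M *\<^sub>R ((x, 0) - (y, 0)))"
    unfolding norm_prod_def by (rule real_le_rsqrt) simp
  also have "\<dots> \<le> M * norm ((x, 0) - (y, 0 :: 'a))"
    by (rule gradient_Lipschitz_shifted[where F = env.env]) (use nonneg gradient_env_bounds in auto)
  finally show ?thesis by (simp add: norm_Pair)
qed

end

section \<open>Strong biLipschitz bounds as Lipschitz bounds\<close>

lemma le_SBilip_iff:
  "ereal \<alpha> \<le> SBilip D G \<longleftrightarrow>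
    (\<forall>x\<in>D. \<forall>y\<in>D. \<alpha> * ((norm (x - y))\<^sup>2 + (norm (G x - G y))\<^sup>2) \<le> 2 * ((x - y) \<bullet> (G x - G y)))"
proof -
  have "\<alpha> \<le> 2 * ((x - y) \<bullet> (G x - G y)) / ((norm (x - y))\<^sup>2 + (norm (G x - G y))\<^sup>2) \<longleftrightarrow>
    \<alpha> * ((norm (x - y))\<^sup>2 + (norm (G x - G y))\<^sup>2) \<le> 2 * ((x - y) \<bullet> (G x - G y))"
    if "x \<noteq> y" for x y
    using that by (intro pos_le_divide_eq add_pos_nonneg) auto
  \<comment> \<open>The pairs with \<open>x = y\<close>, absent from the infimum, add only the
    inequality of 0 with itself.\<close>
  then show ?thesis
    unfolding SBilip_def le_INF_iff by fastforce
qed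

text \<open>Twice an inner product is at most the sum of the squared norms. This keeps
  \<open>1 - \<alpha>\<^sup>2\<close> nonnegative under the square root when \<alpha> is
  positive.\<close>

lemma SBilip_le_1:
  assumes "x \<in> D" "y \<in> D" "x \<noteq> y" "ereal \<alpha> \<le> SBilip D G"
  shows "\<alpha> \<le> 1"
proof -
  define s where "s = (norm (x - y))\<^sup>2 + (norm (G x - G y))\<^sup>2"
  have "0 < s" unfolding s_def using assms by (intro add_pos_nonneg) auto
  have "\<alpha> * s \<le> 2 * ((x - y) \<bullet> (G x - G y))"
    using assms unfolding le_SBilip_iff s_def by blast
  also have "2 * ((x - y) \<bullet> (G x - G y)) = s - (norm ((x - y) - (G x - G y)))\<^sup>2"
    by (simp add: s_def dot_norm_neg)
  also have "\<dots> \<le> 1 * s" by simp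
  finally show ?thesis using \<open>0 < s\<close> by (simp only: mult_le_cancel_right)
qed

text \<open>Square the right-hand bound and expand: the terms in the squared norm of
  \<open>u\<close> divided by \<open>\<alpha>\<^sup>2\<close> cancel, and multiplying by \<alpha>
  gives the left-hand one.\<close>

lemma biLipschitz_iff_Lipschitz:
  fixes u v :: "'a::real_inner"
  assumes \<alpha>: "0 < \<alpha>" "\<alpha> \<le> 1"
  shows "\<alpha> * ((norm u)\<^sup>2 + (norm v)\<^sup>2) \<le> 2 * (u \<bullet> v) \<longleftrightarrow>
    norm (v - (1 / \<alpha>) *\<^sub>R u) \<le> sqrt (1 - \<alpha>\<^sup>2) / \<alpha> * norm u"
proof -
  have "\<alpha>\<^sup>2 \<le> 1" using \<alpha> by (simp add: power_le_one)
  then have "(sqrt (1 - \<alpha>\<^sup>2) / \<alpha> * norm u)\<^sup>2 = (1 - \<alpha>\<^sup>2) / \<alpha>\<^sup>2 * (norm u)\<^sup>2" and pos: "0 \<le> sqrt (1 - \<alpha>\<^sup>2) / \<alpha> * norm u"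
    using \<alpha> by (simp_all add: power_mult_distrib power_divide)
  moreover have "(norm (v - (1 / \<alpha>) *\<^sub>R u))\<^sup>2 = (norm v)\<^sup>2 - 2 / \<alpha> * (u \<bullet> v) + (norm u)\<^sup>2 / \<alpha>\<^sup>2"
    unfolding power2_norm_eq_inner
    by (simp add: inner_diff_left inner_diff_right inner_commute power2_eq_square)
  ultimately have "(norm (v - (1 / \<alpha>) *\<^sub>R u))\<^sup>2 \<le> (sqrt (1 - \<alpha>\<^sup>2) / \<alpha> * norm u)\<^sup>2
    \<longleftrightarrow> (norm v)\<^sup>2 - 2 / \<alpha> * (u \<bullet> v) + (norm u)\<^sup>2 / \<alpha>\<^sup>2 \<le> (norm u)\<^sup>2 / \<alpha>\<^sup>2 - (norm u)\<^sup>2"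
    using \<alpha> by (simp add: diff_divide_distrib left_diff_distrib)
  also have "\<dots> \<longleftrightarrow> (norm u)\<^sup>2 + (norm v)\<^sup>2 \<le> 2 * (u \<bullet> v) / \<alpha>"
    by auto
  also have "\<dots> \<longleftrightarrow> \<alpha> * ((norm u)\<^sup>2 + (norm v)\<^sup>2) \<le> 2 * (u \<bullet> v)"
    using \<alpha> by (simp add: pos_le_divide_eq mult.commute)
  finally show ?thesis
    using pos abs_le_square_iff[of "norm (v - (1 / \<alpha>) *\<^sub>R u)" "sqrt (1 - \<alpha>\<^sup>2) / \<alpha> * norm u"]
    by (simp only: abs_norm_cancel abs_of_nonneg)
qed

theorem theorem8:
  fixes E :: "'a::{real_inner, complete_space} set"
    and G :: "'a \<Rightarrow> 'a"
    and \<alpha> :: real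
  assumes "strongly_biLipschitz E G"
    and "SBilip E G = ereal \<alpha>"
  shows "(\<exists>H. SBilip_preserving_extension E G H) \<and>
         (\<forall>p. \<bar>convex_envelope (ext_aux E G \<alpha>) p\<bar> \<noteq> \<infinity>) \<and>
         (\<forall>x. \<exists>v. GDERIV (ext_env E G \<alpha>) (x, 0) :> v) \<and>
         SBilip_preserving_extension E G (explicit_ext E G \<alpha>)"
proof -
  have "0 < \<alpha>" using assms by (simp add: strongly_biLipschitz_def)
  \<comment> \<open>A real constant forces two distinct points: they give both
    \<open>\<alpha> \<le> 1\<close> and a nonempty \<open>E\<close>.\<close>
  obtain x0 y0 where xy: "x0 \<in> E" "y0 \<in> E" "x0 \<noteq> y0"
    using SBilip_finite_iff[of E G] assms unfolding strongly_biLipschitz_def by auto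
  have "\<alpha> \<le> 1" using SBilip_le_1[OF xy, of \<alpha> G] assms(2) by simp
  note \<alpha> = \<open>0 < \<alpha>\<close> \<open>\<alpha> \<le> 1\<close>
  define M where "M = sqrt (1 - \<alpha>\<^sup>2) / \<alpha>"
  define f where "f z = G z - (1 / \<alpha>) *\<^sub>R z" for z
  have f_diff: "f x - f y = (G x - G y) - (1 / \<alpha>) *\<^sub>R (x - y)" for x y
    by (simp add: f_def algebra_simps)
  interpret Lipschitz_data E f M
  proof
    show "E \<noteq> {}" using xy by blast
    show "0 \<le> M" using \<alpha> by (simp add: M_def power_le_one)
    show "norm (f x - f y) \<le> M * norm (x - y)" if "x \<in> E" "y \<in> E" for x y
      using le_SBilip_iff[of \<alpha> E G] assms(2) that
      unfolding f_diff M_def biLipschitz_iff_Lipschitz[OF \<alpha>, symmetric] by simp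
  qed
  have aux: "ext_aux E G \<alpha> = (\<lambda>p. ereal (g p))"
  proof
    fix p :: "'a \<times> 'a"
    obtain x y where p: "p = (x, y)" by (cases p)
    define c where "c = sqrt (1 - \<alpha>\<^sup>2) / \<alpha> * ((norm x)\<^sup>2 / 2 + (norm y)\<^sup>2)"
    define h where "h z = G z \<bullet> y - (1 / \<alpha>) * (z \<bullet> y) + sqrt (1 - \<alpha>\<^sup>2) / (2 * \<alpha>) * (norm (x - z))\<^sup>2" for z
    have h: "upper z p = h z + c" for z
      unfolding upper_def p h_def c_def by (simp add: f_def M_def inner_diff_left)
    \<comment> \<open>The affine minorant at \<open>x0\<close> bounds the family below, so the
      infimum in the extended reals agrees with the real one.\<close>
    have "bdd_below (h ` E)"
    proof (rule bdd_belowI2)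
      show "lower x0 p - c \<le> h z" if "z \<in> E" for z
        using lower_le_upper[OF xy(1) that, of p] by (simp add: h)
    qed
    have "ereal (INF z\<in>E. h z) = (INF z\<in>E. ereal (h z))"
      using ereal_Inf'[OF \<open>bdd_below (h ` E)\<close>] nonempty by (simp add: image_comp)
    then have "(INF z\<in>E. ereal (h z)) + ereal c = ereal ((INF z\<in>E. h z) + c)"
      by (simp only: plus_ereal.simps(1)[symmetric])
    moreover have "ext_aux E G \<alpha> p = (INF z\<in>E. ereal (h z)) + ereal c"
      by (simp only: ext_aux_def p h_def c_def prod.case)
    ultimately have "ext_aux E G \<alpha> p = ereal ((INF z\<in>E. h z) + c)" by simp
    also have "(INF z\<in>E. h z) + c = g p"
    proof (rule antisym)
      show "(INF z\<in>E. h z) + c \<le> g p"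
        by (rule g_greatest) (simp add: h cINF_lower[OF \<open>bdd_below (h ` E)\<close>])
      have "g p - c \<le> (INF z\<in>E. h z)"
        by (rule cINF_greatest[OF nonempty]) (use g_le[of _ p] in \<open>simp add: h algebra_simps\<close>)
      then show "g p \<le> (INF z\<in>E. h z) + c" by simp
    qed
    finally show "ext_aux E G \<alpha> p = ereal (g p)" .
  qed
  have env: "ext_env E G \<alpha> = env.env"
    by (simp add: fun_eq_iff ext_env_def aux env.env_def)
  have fin: "\<bar>convex_envelope (ext_aux E G \<alpha>) p\<bar> \<noteq> \<infinity>" for p
    unfolding aux env.ereal_env[symmetric] by simp
  have deriv: "\<exists>v. GDERIV (ext_env E G \<alpha>) (x, 0) :> v" for x
    unfolding env using env_GDERIV by blast
  define H where "H = explicit_ext E G \<alpha>"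
  have H: "H x = snd (gradient env.env (x, 0)) + (1 / \<alpha>) *\<^sub>R x" for x
    by (simp add: H_def explicit_ext_def env)
  have eq: "H x = G x" if "x \<in> E" for x
    using gradient_env_on[OF that] by (simp add: H f_def)
  have "ereal \<alpha> \<le> SBilip UNIV H"
    unfolding le_SBilip_iff
  proof (intro ballI)
    fix x y
    have "(H x - H y) - (1 / \<alpha>) *\<^sub>R (x - y) = snd (gradient env.env (x, 0)) - snd (gradient env.env (y, 0))"
      by (simp add: H algebra_simps)
    then show "\<alpha> * ((norm (x - y))\<^sup>2 + (norm (H x - H y))\<^sup>2) \<le> 2 * ((x - y) \<bullet> (H x - H y))"
      using snd_gradient_env_Lipschitz[of x y]
      unfolding biLipschitz_iff_Lipschitz[OF \<alpha>] M_def by simp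
  qed
  \<comment> \<open>The constant cannot exceed \<alpha>: enlarging the domain only lowers the
    infimum, and on \<open>E\<close> the maps \<open>H\<close> and \<open>G\<close> agree.\<close>
  moreover have "SBilip UNIV H \<le> SBilip E H"
    unfolding SBilip_def by (rule INF_superset_mono) auto
  moreover have "SBilip E H = SBilip E G"
    unfolding SBilip_def by (rule INF_cong) (auto simp: eq)
  ultimately have "SBilip UNIV H = ereal \<alpha>" using assms(2) by simp
  then have "SBilip_preserving_extension E G H"
    using \<alpha> assms(2) eq by (simp add: SBilip_preserving_extension_def strongly_biLipschitz_def)
  then show ?thesis using fin deriv unfolding H_def by blast
qed

end
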